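(* Let $\circledcirc$ be an arbitrary unary modal operator, let $\mathcal{L}(\circledcirc)$ be the language of classical propositional logic over the set $\mathbf{P}$ of propositional variables enriched with $\circledcirc$, let $S$ be the set of all maximal consistent sets, and let $V$ assign to each $\mathcal{L}(\circledcirc)$-formula its truth set $V(\phi)\subseteq S$ in a model with domain $S$. Let $\Sigma$ be a maximal consistent set. If for all $\phi\in\mathcal{L}(\circledcirc)$ we have $$\text{for each } p\in\mathbf{P}\cup\{\circledcirc\phi\},\quad p\in\Sigma \text{ iff } \Sigma\in V(p),$$ then for all $\phi\in\mathcal{L}(\circledcirc)$ we have $$\phi\in\Sigma \text{ iff } V(\phi)\in\pi_\Sigma.$$
   Context: Formulas of $\mathcal{L}(\circledcirc)$ are built from propositional variables in $\mathbf{P}$ by $\neg$, $\wedge$ and $\circledcirc$. A proof system $\vdash$ for $\mathcal{L}(\circledcirc)$ extending classical propositional logic is fixed. A set $\Sigma$ of formulas is consistent if $\Sigma\nvdash\bot$, maximal if for every formula $\phi$ we have $\phi\in\Sigma$ or $\neg\phi\in\Sigma$, and maximal consistent if it is both. Maximal consistent sets have the usual properties: $\top\in\Sigma$; $\phi,\psi\in\Sigma$ implies $\phi\wedge\psi\in\Sigma$; $\phi\in\Sigma$ and $\vdash\phi\to\psi$ imply $\psi\in\Sigma$; $\bot\notin\Sigma$; $\phi\in\Sigma$ iff $\neg\phi\notin\Sigma$. $V(\phi)$ denotes the set of states of the model (here: elements of $S$) at which $\phi$ is true; Boolean connectives are interpreted classically, so $V(\neg\phi)=S\setminus V(\phi)$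 and $V(\phi\wedge\psi)=V(\phi)\cap V(\psi)$. For $w\in S$, $\pi_w=\{X\subseteq S\mid w\in X\}$ is the principal ultrafilter generated by $w$. *)

theory Defs
  imports Main
begin

datatype 'p fm =
    Var 'p
  | Neg "'p fm"
  | Conj "'p fm" "'p fm"
  | Circ "'p fm"

definition Imp :: "'p fm \<Rightarrow> 'p fm \<Rightarrow> 'p fm" where
  "Imp \<phi> \<psi> = Neg (Conj \<phi> (Neg \<psi>))"

(* The language has no propositional constants, so falsum is p \<and> \<not>p for a
   fixed but unspecified variable p. *)
definition Bot :: "'p fm" where
  "Bot = Conj (Var undefined) (Neg (Var undefined))"

(* For classical propositional logic, variables and formulas of the form Circ \<phi>
   are both atoms: v chooses their truth values freely. *)
primrec prop_eval :: "('p fm \<Rightarrow> bool) \<Rightarrow> 'p fm \<Rightarrow> bool" where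
  "prop_eval v (Var p) = v (Var p)"
| "prop_eval v (Neg \<phi>) = (\<not> prop_eval v \<phi>)"
| "prop_eval v (Conj \<phi> \<psi>) = (prop_eval v \<phi> \<and> prop_eval v \<psi>)"
| "prop_eval v (Circ \<phi>) = v (Circ \<phi>)"

definition tautology :: "'p fm \<Rightarrow> bool" where
  "tautology \<phi> \<longleftrightarrow> (\<forall>v. prop_eval v \<phi>)"

(* D \<Gamma> \<phi> reads: \<phi> is derivable from \<Gamma>. Nothing is required of Circ, and neither
   finitariness nor the deduction theorem is assumed, so both local and global
   readings of derivability from assumptions are covered. *)
locale classical_proof_system =
  fixes D :: "'p fm set \<Rightarrow> 'p fm \<Rightarrow> bool"
  assumes assumption: "\<phi> \<in> \<Gamma> \<Longrightarrow> D \<Gamma> \<phi>"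
    and weakening: "D \<Gamma> \<phi> \<Longrightarrow> \<Gamma> \<subseteq> \<Delta> \<Longrightarrow> D \<Delta> \<phi>"
    and cut: "(\<And>\<psi>. \<psi> \<in> \<Delta> \<Longrightarrow> D \<Gamma> \<psi>) \<Longrightarrow> D (\<Gamma> \<union> \<Delta>) \<phi> \<Longrightarrow> D \<Gamma> \<phi>"
    and taut: "tautology \<phi> \<Longrightarrow> D \<Gamma> \<phi>"
    and modus_ponens: "D \<Gamma> (Imp \<phi> \<psi>) \<Longrightarrow> D \<Gamma> \<phi> \<Longrightarrow> D \<Gamma> \<psi>"

definition consistent :: "('p fm set \<Rightarrow> 'p fm \<Rightarrow> bool) \<Rightarrow> 'p fm set \<Rightarrow> bool" where
  "consistent D \<Sigma> \<longleftrightarrow> \<not> D \<Sigma> Bot"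

definition maximal :: "'p fm set \<Rightarrow> bool" where
  "maximal \<Sigma> \<longleftrightarrow> (\<forall>\<phi>. \<phi> \<in> \<Sigma> \<or> Neg \<phi> \<in> \<Sigma>)"

definition maximal_consistent :: "('p fm set \<Rightarrow> 'p fm \<Rightarrow> bool) \<Rightarrow> 'p fm set \<Rightarrow> bool" where
  "maximal_consistent D \<Sigma> \<longleftrightarrow> maximal \<Sigma> \<and> consistent D \<Sigma>"

(* V gives the truth sets of some model with domain S. Only the Boolean
   connectives are constrained: the interpretation of Circ is arbitrary. *)
definition truth_sets :: "'s set \<Rightarrow> ('p fm \<Rightarrow> 's set) \<Rightarrow> bool" where
  "truth_sets S V \<longleftrightarrow>
     (\<forall>\<phi>. V \<phi> \<subseteq> S) \<and>
     (\<forall>\<phi>. V (Neg \<phi>) = S - V \<phi>) \<and>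
     (\<forall>\<phi> \<psi>. V (Conj \<phi> \<psi>) = V \<phi> \<inter> V \<psi>)"

definition principal_ultrafilter :: "'s set \<Rightarrow> 's \<Rightarrow> 's set set" where
  "principal_ultrafilter S w = {X. X \<subseteq> S \<and> w \<in> X}"

end

theory Submission
  imports Defs
begin

text \<open>
  Since \<^term>\<open>V \<phi>\<close> is a subset of \<^term>\<open>S\<close>, it lies in the principal ultrafilter at \<^term>\<open>\<Sigma>\<close>
  exactly when \<^term>\<open>\<Sigma> \<in> V \<phi>\<close>. The claim is therefore a truth lemma at the single point
  \<^term>\<open>\<Sigma>\<close>, proved by induction on \<^term>\<open>\<phi>\<close>. The hypothesis supplies it outright for variables
  and for formulas with outermost operator \<^const>\<open>Circ\<close>. The Boolean cases match the clauses
  for truth sets with the clauses for membership in a maximal consistent set. For negation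
  the latter is maximality in one direction and consistency in the other (\<open>Neg_mem_iff\<close>);
  for conjunction it holds because such a set contains everything derivable from it
  (\<open>derivable_mem\<close>, \<open>Conj_mem_iff\<close>).
\<close>

context classical_proof_system
begin

lemma contradiction_inconsistent:
  assumes "D \<Gamma> \<phi>" and "D \<Gamma> (Neg \<phi>)"
  shows "\<not> consistent D \<Gamma>"
proof -
  have "tautology (Imp \<phi> (Imp (Neg \<phi>) Bot))"
    by (simp add: tautology_def Imp_def)
  then have "D \<Gamma> Bot"
    using assms by (blast intro: taut modus_ponens)
  then show ?thesis
    by (simp add: consistent_def)
qed

text \<open>
  If a derivable formula were missing, maximality would put its negation into the set,
  making both derivable.
\<close>

lemma derivable_mem:
  assumes "maximal_consistent D \<Gamma>" and "D \<Gamma> \<phi>"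
  shows "\<phi> \<in> \<Gamma>"
  using assms contradiction_inconsistent assumption
  unfolding maximal_consistent_def maximal_def by blast

lemma tautological_consequence_mem:
  assumes "maximal_consistent D \<Gamma>" and "tautology (Imp \<phi> \<psi>)" and "\<phi> \<in> \<Gamma>"
  shows "\<psi> \<in> \<Gamma>"
  using assms by (blast intro: derivable_mem modus_ponens taut assumption)

lemma Neg_mem_iff:
  assumes "maximal_consistent D \<Gamma>"
  shows "Neg \<phi> \<in> \<Gamma> \<longleftrightarrow> \<phi> \<notin> \<Gamma>"
  using assms contradiction_inconsistent assumption
  unfolding maximal_consistent_def maximal_def by blast

lemma Conj_mem_iff:
  assumes mc: "maximal_consistent D \<Gamma>"
  shows "Conj \<phi> \<psi> \<in> \<Gamma> \<longleftrightarrow> \<phi> \<in> \<Gamma> \<and> \<psi> \<in> \<Gamma>"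
proof
  assume "Conj \<phi> \<psi> \<in> \<Gamma>"
  moreover have "tautology (Imp (Conj \<phi> \<psi>) \<phi>)" and "tautology (Imp (Conj \<phi> \<psi>) \<psi>)"
    by (simp_all add: tautology_def Imp_def)
  ultimately show "\<phi> \<in> \<Gamma> \<and> \<psi> \<in> \<Gamma>"
    using tautological_consequence_mem[OF mc] by blast
next
  assume mem: "\<phi> \<in> \<Gamma> \<and> \<psi> \<in> \<Gamma>"
  have "tautology (Imp \<phi> (Imp \<psi> (Conj \<phi> \<psi>)))"
    by (simp add: tautology_def Imp_def)
  then have "Imp \<psi> (Conj \<phi> \<psi>) \<in> \<Gamma>"
    using tautological_consequence_mem[OF mc] mem by blast
  then show "Conj \<phi> \<psi> \<in> \<Gamma>"
    using mem by (blast intro: derivable_mem[OF mc] modus_ponens assumption)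
qed

end

theorem theorem6:
  fixes D :: "'p fm set \<Rightarrow> 'p fm \<Rightarrow> bool"
    and S :: "'p fm set set"
    and V :: "'p fm \<Rightarrow> 'p fm set set"
    and \<Sigma> :: "'p fm set"
  assumes "classical_proof_system D"
    and "S = {\<Gamma>. maximal_consistent D \<Gamma>}"
    and "truth_sets S V"
    and "maximal_consistent D \<Sigma>"
    and "\<forall>\<phi>. \<forall>p \<in> range Var \<union> {Circ \<phi>}. p \<in> \<Sigma> \<longleftrightarrow> \<Sigma> \<in> V p"
  shows "\<forall>\<phi>. \<phi> \<in> \<Sigma> \<longleftrightarrow> V \<phi> \<in> principal_ultrafilter S \<Sigma>"
proof
  interpret classical_proof_system D by fact
  have \<Sigma>_in_S: "\<Sigma> \<in> S"
    using assms(2,4) by simp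
  have V_Neg: "V (Neg \<psi>) = S - V \<psi>"
    and V_Conj: "V (Conj \<psi> \<chi>) = V \<psi> \<inter> V \<chi>"
    and V_subset: "V \<psi> \<subseteq> S" for \<psi> \<chi>
    using assms(3) by (auto simp: truth_sets_def)
  fix \<phi>
  have "\<phi> \<in> \<Sigma> \<longleftrightarrow> \<Sigma> \<in> V \<phi>"
  proof (induction \<phi>)
    case (Var p)
    show ?case using assms(5) by blast
  next
    case (Neg \<psi>)
    then show ?case
      using \<Sigma>_in_S by (simp add: V_Neg Neg_mem_iff[OF assms(4)])
  next
    case (Conj \<psi> \<chi>)
    then show ?case
      by (simp add: V_Conj Conj_mem_iff[OF assms(4)])
  next
    case (Circ \<psi>)
    show ?case using assms(5) by blast
  qed
  then show "\<phi> \<in> \<Sigma> \<longleftrightarrow> V \<phi> \<in> principal_ultrafilter S \<Sigma>"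
    using V_subset by (simp add: principal_ultrafilter_def)
qed

end
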